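(* There exist hyperaperiodic elements in $\mathrm{Free}(\{0,1\}^{T_\Delta})/\sim$, i.e. elements $[\alpha]$ such that the closure in $\{0,1\}^{T_\Delta}/\sim$ of the connected component of $[\alpha]$ in $\mathcal{T}^{\{0,1\}}_\Delta$ is contained in $\mathrm{Free}(\{0,1\}^{T_\Delta})/\sim$.
   Context: $\Delta>2$. $T_\Delta$ is the infinite $\Delta$-regular tree with a fixed root $\mathfrak r$; $\operatorname{Aut}(T_\Delta)$ acts on $\{0,1\}^{T_\Delta}$ (product topology) by $(g\cdot x)(v)=x(g^{-1}(v))$, and $\operatorname{Aut}^o(T_\Delta)$ is the stabilizer of $\mathfrak r$. $x\sim y$ iff $y=g\cdot x$ for some $g\in\operatorname{Aut}^o(T_\Delta)$; $\{0,1\}^{T_\Delta}/\sim$ carries the quotient topology. $\mathrm{Free}(\{0,1\}^{T_\Delta})$ is the set of $x$ with $g\cdot x\ne x$ for every non-identity $g\in\operatorname{Aut}(T_\Delta)$. The graph $\mathcal{G}_{\{0,1\},\Delta}$ on $\{0,1\}^{T_\Delta}/\sim$ joins $[x],[y]$ iff for every $z\in[x]$ there is $g\in\operatorname{Aut}(T_\Delta)$ moving $\mathfrak r$ to one of its neighbors with $g\cdot z\in[y]$; $\mathcal{T}^{\{0,1\}}_\Delta$ is its restriction to $\mathrm{Free}(\{0,1\}^{T_\Delta})/\sim$. *)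

theory Defs
  imports "HOL-Analysis.Analysis"
begin

text \<open>
  A graph on a vertex type is given by its adjacency relation. The infinite \<open>\<Delta>\<close>-regular
  tree is unique up to isomorphism, so \<open>T\<^sub>\<Delta>\<close> is represented by an arbitrary relation satisfying
  the predicate \<open>regular_tree\<close> below, whose vertices are all elements of the type.
\<close>

definition is_cycle :: "('v \<Rightarrow> 'v \<Rightarrow> bool) \<Rightarrow> 'v list \<Rightarrow> bool" where
  "is_cycle E c \<longleftrightarrow> 3 \<le> length c \<and> distinct c \<and> successively E c \<and> E (last c) (hd c)"

definition is_tree :: "('v \<Rightarrow> 'v \<Rightarrow> bool) \<Rightarrow> bool" where
  "is_tree E \<longleftrightarrow> symp E \<and> irreflp E \<and> (\<forall>u v. E\<^sup>*\<^sup>* u v) \<and> (\<nexists>c. is_cycle E c)"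

definition regular_tree :: "nat \<Rightarrow> ('v \<Rightarrow> 'v \<Rightarrow> bool) \<Rightarrow> bool" where
  "regular_tree \<Delta> E \<longleftrightarrow> is_tree E \<and> (\<forall>v. finite {w. E v w} \<and> card {w. E v w} = \<Delta>)"

definition Aut :: "('v \<Rightarrow> 'v \<Rightarrow> bool) \<Rightarrow> ('v \<Rightarrow> 'v) set" where
  "Aut E = {g. bij g \<and> (\<forall>u v. E (g u) (g v) \<longleftrightarrow> E u v)}"

definition Aut_stab :: "('v \<Rightarrow> 'v \<Rightarrow> bool) \<Rightarrow> 'v \<Rightarrow> ('v \<Rightarrow> 'v) set" where
  "Aut_stab E r = {g \<in> Aut E. g r = r}"

text \<open>Points of \<open>{0,1}\<^sup>T\<close> are functions into \<^typ>\<open>bool\<close>.\<close>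

definition act :: "('v \<Rightarrow> 'v) \<Rightarrow> ('v \<Rightarrow> bool) \<Rightarrow> ('v \<Rightarrow> bool)" where
  "act g x = (\<lambda>v. x (inv g v))"

definition config_topology :: "('v \<Rightarrow> bool) topology" where
  "config_topology = product_topology (\<lambda>_. discrete_topology UNIV) UNIV"

definition orbit_rel :: "('v \<Rightarrow> 'v \<Rightarrow> bool) \<Rightarrow> 'v \<Rightarrow> (('v \<Rightarrow> bool) \<times> ('v \<Rightarrow> bool)) set" where
  "orbit_rel E r = {(x, y). \<exists>g \<in> Aut_stab E r. y = act g x}"

definition quotient_topology :: "'a topology \<Rightarrow> ('a \<times> 'a) set \<Rightarrow> 'a set topology" where
  "quotient_topology X R =
     topology (\<lambda>U. U \<subseteq> topspace X // R \<and> openin X {x \<in> topspace X. R `` {x} \<in> U})"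

lemma openin_quotient_topology:
  "openin (quotient_topology X R) U \<longleftrightarrow>
     U \<subseteq> topspace X // R \<and> openin X {x \<in> topspace X. R `` {x} \<in> U}"
proof -
  have "istopology (\<lambda>U. U \<subseteq> topspace X // R \<and> openin X {x \<in> topspace X. R `` {x} \<in> U})"
    unfolding istopology_def
  proof (intro conjI allI impI)
    fix S T
    assume S: "S \<subseteq> topspace X // R \<and> openin X {x \<in> topspace X. R `` {x} \<in> S}"
      and T: "T \<subseteq> topspace X // R \<and> openin X {x \<in> topspace X. R `` {x} \<in> T}"
    show "S \<inter> T \<subseteq> topspace X // R" using S by blast
    have "openin X ({x \<in> topspace X. R `` {x} \<in> S} \<inter> {x \<in> topspace X. R `` {x} \<in> T})"
      by (rule openin_Int[OF conjunct2[OF S] conjunct2[OF T]])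
    moreover have "{x \<in> topspace X. R `` {x} \<in> S \<inter> T} =
        {x \<in> topspace X. R `` {x} \<in> S} \<inter> {x \<in> topspace X. R `` {x} \<in> T}" by blast
    ultimately show "openin X {x \<in> topspace X. R `` {x} \<in> S \<inter> T}" by (simp only:)
  next
    fix K
    assume K: "\<forall>U\<in>K. U \<subseteq> topspace X // R \<and> openin X {x \<in> topspace X. R `` {x} \<in> U}"
    then show "\<Union>K \<subseteq> topspace X // R" by blast
    have "openin X (\<Union>U\<in>K. {x \<in> topspace X. R `` {x} \<in> U})"
      using K by (intro openin_clauses(3)) blast
    moreover have "{x \<in> topspace X. R `` {x} \<in> \<Union>K} =
        (\<Union>U\<in>K. {x \<in> topspace X. R `` {x} \<in> U})" by blast
    ultimately show "openin X {x \<in> topspace X. R `` {x} \<in> \<Union>K}" by (simp only:)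
  qed
  then show ?thesis unfolding quotient_topology_def by (simp only: topology_inverse')
qed

definition Free :: "('v \<Rightarrow> 'v \<Rightarrow> bool) \<Rightarrow> ('v \<Rightarrow> bool) set" where
  "Free E = {x. \<forall>g \<in> Aut E. g \<noteq> id \<longrightarrow> act g x \<noteq> x}"

definition config_quot :: "('v \<Rightarrow> 'v \<Rightarrow> bool) \<Rightarrow> 'v \<Rightarrow> ('v \<Rightarrow> bool) set set" where
  "config_quot E r = UNIV // orbit_rel E r"

definition config_quot_topology ::
  "('v \<Rightarrow> 'v \<Rightarrow> bool) \<Rightarrow> 'v \<Rightarrow> ('v \<Rightarrow> bool) set topology" where
  "config_quot_topology E r = quotient_topology config_topology (orbit_rel E r)"

definition Free_quot :: "('v \<Rightarrow> 'v \<Rightarrow> bool) \<Rightarrow> 'v \<Rightarrow> ('v \<Rightarrow> bool) set set" where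
  "Free_quot E r = Free E // orbit_rel E r"

definition adj_G ::
  "('v \<Rightarrow> 'v \<Rightarrow> bool) \<Rightarrow> 'v \<Rightarrow> ('v \<Rightarrow> bool) set \<Rightarrow> ('v \<Rightarrow> bool) set \<Rightarrow> bool" where
  "adj_G E r X Y \<longleftrightarrow> X \<in> config_quot E r \<and> Y \<in> config_quot E r \<and>
     (\<forall>z \<in> X. \<exists>g \<in> Aut E. E r (g r) \<and> act g z \<in> Y)"

definition adj_T ::
  "('v \<Rightarrow> 'v \<Rightarrow> bool) \<Rightarrow> 'v \<Rightarrow> ('v \<Rightarrow> bool) set \<Rightarrow> ('v \<Rightarrow> bool) set \<Rightarrow> bool" where
  "adj_T E r X Y \<longleftrightarrow> adj_G E r X Y \<and> X \<in> Free_quot E r \<and> Y \<in> Free_quot E r"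

text \<open>
  The adjacency is symmetric when \<open>E\<close> is; \<^const>\<open>equivclp\<close> makes the undirected reading explicit.
\<close>

definition component_T ::
  "('v \<Rightarrow> 'v \<Rightarrow> bool) \<Rightarrow> 'v \<Rightarrow> ('v \<Rightarrow> bool) set \<Rightarrow> ('v \<Rightarrow> bool) set set" where
  "component_T E r X = {Y. equivclp (adj_T E r) X Y}"

definition hyperaperiodic :: "('v \<Rightarrow> 'v \<Rightarrow> bool) \<Rightarrow> 'v \<Rightarrow> ('v \<Rightarrow> bool) set \<Rightarrow> bool" where
  "hyperaperiodic E r X \<longleftrightarrow> X \<in> Free_quot E r \<and>
     config_quot_topology E r closure_of component_T E r X \<subseteq> Free_quot E r"

end

theory Submission
  imports Defs
begin

text \<open>
  If a configuration \<open>y\<close> in the closure of the orbit of \<open>x\<close> is fixed by \<open>g\<close> with \<open>g u \<noteq> u\<close>, then \<open>x\<close>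
  contains two isomorphic balls of any prescribed radius whose centres are at the distance \<open>n\<close> from
  \<open>u\<close> to \<open>g u\<close>. So it suffices to construct \<open>x\<close> such that, for each \<open>n \<ge> 1\<close>, balls of some radius
  \<open>D n\<close> around vertices at distance \<open>n\<close> are never isomorphic.

  Orient the tree towards an end: every vertex has one parent and \<open>d = \<Delta> - 1 \<ge> 2\<close> children, and an
  integer level. Colour the children of \<open>v\<close> so that the number of coloured ones is a prescribed
  weight in \<open>{0..d}\<close>. Siblings receive different weights, so exactly one value is missing among
  the weights of the children of \<open>v\<close>; it is \<open>0\<close> or \<open>d\<close> according to a bit that depends only on the
  level of \<open>v\<close>. Once the direction of the parent is known locally, siblings are told apart by their
  weights and the bits along upward paths can be read off. The bit sequence is a Toeplitz sequence
  that no shift and no reflection of the integers preserves on a long window: reflections are what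
  an isomorphism reversing upward paths would induce, and shifts what a change of level would induce.
\<close>

section \<open>A Toeplitz sequence without long symmetries\<close>

text \<open>
  Found by computer search: 15 is the least period for which a binary word with one undetermined
  residue class (here the multiples of 15) already violates every nontrivial shift and every
  reflection in the form required by \<open>toeplitz_breaks_reflection\<close>.
\<close>

definition ones :: "int set" where
  "ones = {5, 7, 9, 11, 12, 13, 14}"

text \<open>The residue class left open by \<open>ones\<close> is filled with the sequence itself.
  The value at \<open>0\<close> is arbitrary; fixing it makes the recursion terminate.\<close>

function toeplitz :: "int \<Rightarrow> bool" where
  "toeplitz k = (if k = 0 then False
     else if k mod 15 = 0 then toeplitz (k div 15)
     else k mod 15 \<in> ones)"
  by pat_completeness auto
termination
  by (relation "Wellfounded.measure (\<lambda>k. nat \<bar>k\<bar>)") auto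

declare toeplitz.simps [simp del]

lemma toeplitz_nonmultiple:
  "k mod 15 \<noteq> 0 \<Longrightarrow> toeplitz k \<longleftrightarrow> k mod 15 \<in> ones"
  by (subst toeplitz.simps) auto

lemma toeplitz_multiple: "toeplitz (15 * k) = toeplitz k"
  by (subst toeplitz.simps) (auto simp: toeplitz.simps[of 0])

text \<open>Factors of 15 are divided out of \<open>n\<close>, which scales the progression by 15;
  for any other \<open>n\<close> a single residue modulo 15 works. A whole residue class of
  disagreements bounds the window length independently of its position.\<close>

lemma toeplitz_breaks_shift_progression:
  fixes n :: int
  assumes "n \<noteq> 0"
  shows "\<exists>P k0. P > 0 \<and> (\<forall>k. k mod P = k0 mod P \<longrightarrow> toeplitz k \<noteq> toeplitz (k + n))"
  using assms
proof (induction "nat \<bar>n\<bar>" arbitrary: n rule: less_induct)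
  case less
  show ?case
  proof (cases "n mod 15 = 0")
    case True
    define m where "m = n div 15"
    have n: "n = 15 * m" using True by (auto simp: m_def)
    obtain P k0 where P: "P > 0" "\<And>k. k mod P = k0 mod P \<Longrightarrow> toeplitz k \<noteq> toeplitz (k + m)"
      using less.hyps[of m] less.prems n by (auto simp: abs_mult)
    have "toeplitz k \<noteq> toeplitz (k + n)" if "k mod (15 * P) = (15 * k0) mod (15 * P)" for k
    proof -
      have "15 dvd k" using that
        by (metis dvd_mod_iff dvd_triv_left)
      then obtain j where j: "k = 15 * j" by blast
      have "j mod P = k0 mod P" using that by (simp add: j flip: mult_mod_right)
      with P(2) have "toeplitz j \<noteq> toeplitz (j + m)" by blast
      moreover have "k + n = 15 * (j + m)" by (simp add: j n)
      ultimately show ?thesis using toeplitz_multiple j by metis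
    qed
    with P(1) show ?thesis by (intro exI[of _ "15 * P"] exI[of _ "15 * k0"]) auto
  next
    case False
    define s where "s = n mod 15"
    have "s \<in> {1..14}" using False pos_mod_bound[of 15 n] pos_mod_sign[of 15 n] by (auto simp: s_def)
    then have "s \<in> set [1..14]" by simp
    \<comment> \<open>Both \<open>j\<close> and \<open>j + s\<close> avoid the multiples of 15, so
      \<open>ones\<close> decides both values; lists make the finite search executable.\<close>
    moreover have "\<forall>s \<in> set [1..14]. \<exists>j \<in> set [1..14]. (j + s) mod 15 \<noteq> 0 \<and>
        (j \<in> ones) \<noteq> ((j + s) mod 15 \<in> ones)"
      by code_simp
    ultimately obtain j where j: "j \<in> {1..14}" "(j + s) mod 15 \<noteq> 0"
        "(j \<in> ones) \<noteq> ((j + s) mod 15 \<in> ones)"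
      unfolding set_upto by blast
    have "toeplitz k \<noteq> toeplitz (k + n)" if "k mod 15 = j mod 15" for k
    proof -
      have k: "k mod 15 = j" using that j(1) by simp
      have "(k + n) mod 15 = (j + s) mod 15" unfolding s_def k[symmetric] by (simp add: mod_simps)
      with j k show ?thesis
        using toeplitz_nonmultiple[of k] toeplitz_nonmultiple[of "k + n"] by auto
    qed
    then show ?thesis by (intro exI[of _ 15] exI[of _ j]) auto
  qed
qed

lemma residue_in_window:
  fixes P m k0 :: int
  assumes "P > 0"
  obtains i where "i < nat P" "(m + int i) mod P = k0 mod P"
proof
  show "nat ((k0 - m) mod P) < nat P" using assms by simp
  show "(m + int (nat ((k0 - m) mod P))) mod P = k0 mod P"
    using assms by (simp add: mod_simps)
qed

lemma toeplitz_breaks_shift: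
  assumes "n \<noteq> 0"
  shows "\<exists>L::nat. \<forall>m. \<exists>i\<le>L. toeplitz (m + int i) \<noteq> toeplitz (m + int i + n)"
proof -
  obtain P k0 where P: "P > 0" "\<And>k. k mod P = k0 mod P \<Longrightarrow> toeplitz k \<noteq> toeplitz (k + n)"
    using toeplitz_breaks_shift_progression[OF assms] by blast
  show ?thesis
    using residue_in_window[OF P(1)] P(2) by (metis less_imp_le)
qed

text \<open>The rising and falling positions always add up to \<open>a + b\<close>, so only residues
  modulo 15 matter and a finite check suffices. The equalities two places apart let
  \<open>preserved_imp_oriented\<close> use \<open>unoriented_step\<close> on both sides of one
  vertex.\<close>

lemma toeplitz_breaks_reflection:
  "\<exists>i\<le>14::nat. toeplitz (a + int i) = toeplitz (a + int i + 2) \<and>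
     toeplitz (b - int i) = toeplitz (b - int i - 2) \<and>
     toeplitz (a + int i) \<noteq> toeplitz (b - int i)"
proof -
  define s where "s = (a + b) mod 15"
  have "s \<in> {0..14}" using pos_mod_bound[of 15 "a + b"] pos_mod_sign[of 15 "a + b"] by (auto simp: s_def)
  then have "s \<in> set [0..14]" by simp
  moreover have "\<forall>s \<in> set [0..14]. \<exists>j \<in> set [0..14]. j mod 15 \<noteq> 0 \<and> (j + 2) mod 15 \<noteq> 0 \<and> (s - j) mod 15 \<noteq> 0 \<and>
      (s - j - 2) mod 15 \<noteq> 0 \<and> (j mod 15 \<in> ones) = ((j + 2) mod 15 \<in> ones) \<and>
      ((s - j) mod 15 \<in> ones) = ((s - j - 2) mod 15 \<in> ones) \<and> (j mod 15 \<in> ones) \<noteq> ((s - j) mod 15 \<in> ones)"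
    by code_simp
  ultimately obtain j where j: "j mod 15 \<noteq> 0" "(j + 2) mod 15 \<noteq> 0" "(s - j) mod 15 \<noteq> 0"
      "(s - j - 2) mod 15 \<noteq> 0" "(j mod 15 \<in> ones) = ((j + 2) mod 15 \<in> ones)"
      "((s - j) mod 15 \<in> ones) = ((s - j - 2) mod 15 \<in> ones)"
      "(j mod 15 \<in> ones) \<noteq> ((s - j) mod 15 \<in> ones)"
    by blast
  obtain i where i: "i < nat 15" "(a + int i) mod 15 = j mod 15"
    by (rule residue_in_window[of 15]) auto
  have "b - int i = (a + b) - (a + int i)" by simp
  then have m3: "(b - int i) mod 15 = (s - j) mod 15"
    unfolding s_def using i(2) by (metis mod_diff_eq mod_mod_trivial)
  then have m4: "(b - int i - 2) mod 15 = (s - j - 2) mod 15"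
    by (metis mod_diff_left_eq)
  have m2: "(a + int i + 2) mod 15 = (j + 2) mod 15"
    using i(2) by (metis mod_add_left_eq)
  have t: "toeplitz (a + int i) \<longleftrightarrow> j mod 15 \<in> ones" "toeplitz (a + int i + 2) \<longleftrightarrow> (j + 2) mod 15 \<in> ones"
     "toeplitz (b - int i) \<longleftrightarrow> (s - j) mod 15 \<in> ones"
     "toeplitz (b - int i - 2) \<longleftrightarrow> (s - j - 2) mod 15 \<in> ones"
    using toeplitz_nonmultiple[of "a + int i"] toeplitz_nonmultiple[of "a + int i + 2"]
      toeplitz_nonmultiple[of "b - int i"] toeplitz_nonmultiple[of "b - int i - 2"]
      i(2) m2 m3 m4 j(1-4) by (simp_all only: not_False_eq_True simp_thms)
  have "i \<le> 14" using i(1) by simp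
  moreover have "toeplitz (a + int i) = toeplitz (a + int i + 2)"
    unfolding t by (rule j(5))
  moreover have "toeplitz (b - int i) = toeplitz (b - int i - 2)"
    unfolding t by (rule j(6))
  moreover have "toeplitz (a + int i) \<noteq> toeplitz (b - int i)"
    unfolding t by (rule j(7))
  ultimately show ?thesis by blast
qed

section \<open>Orienting a regular tree towards an end\<close>

text \<open>Here \<open>h\<close> is the distance from \<open>r\<close> and \<open>q\<close> picks a
  neighbour one step closer. Any edge other than these would close a cycle with the two chains
  descending to \<open>r\<close>.\<close>

lemma tree_rooted_parent:
  fixes E :: "'v \<Rightarrow> 'v \<Rightarrow> bool"
  assumes tree: "is_tree E"
  obtains q :: "'v \<Rightarrow> 'v" and h :: "'v \<Rightarrow> nat"
  where "\<And>v. h v = 0 \<longleftrightarrow> v = r"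
    and "\<And>v. v \<noteq> r \<Longrightarrow> h v = Suc (h (q v))"
    and "\<And>u v. E u v \<longleftrightarrow> v \<noteq> r \<and> u = q v \<or> u \<noteq> r \<and> v = q u"
proof -
  have sym: "E u v \<Longrightarrow> E v u" and irr: "\<not> E v v" and conn: "E\<^sup>*\<^sup>* u v"
    and acyc: "\<not> is_cycle E c" for u v c
    using tree by (auto simp: is_tree_def symp_def irreflp_def)
  define h where "h v = (LEAST n. (E ^^ n) r v)" for v
  have walk: "(E ^^ h v) r v" for v
    unfolding h_def using rtranclp_imp_relpowp[OF conn[of r v]] by (auto intro: LeastI)
  have h_le: "(E ^^ n) r v \<Longrightarrow> h v \<le> n" for n v
    unfolding h_def by (rule Least_le)
  have h0: "h v = 0 \<longleftrightarrow> v = r" for v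
    using walk[of v] h_le[of 0 v] by auto
  have "\<exists>u. E u v \<and> h v = Suc (h u)" if vr: "v \<noteq> r" for v
  proof -
    obtain m where m: "h v = Suc m" using h0 vr by (cases "h v") auto
    with walk[of v] obtain u where u: "(E ^^ m) r u" "E u v" by auto
    have "h v \<le> Suc (h u)" using walk[of u] u(2) by (intro h_le) auto
    with h_le[OF u(1)] m u(2) show ?thesis by auto
  qed
  then obtain q where q: "\<And>v. v \<noteq> r \<Longrightarrow> E (q v) v" "\<And>v. v \<noteq> r \<Longrightarrow> h v = Suc (h (q v))"
    by metis
  have h_iter: "k \<le> h v \<Longrightarrow> h ((q ^^ k) v) = h v - k" for k v
  proof (induction k)
    case (Suc k)
    then have "h ((q ^^ k) v) = h v - k" "(q ^^ k) v \<noteq> r" using h0 by force+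
    with q(2)[of "(q ^^ k) v"] show ?case by simp
  qed simp
  have top: "(q ^^ h v) v = r" for v using h_iter[of "h v" v] h0 by simp
  have E_iter: "E ((q ^^ Suc k) v) ((q ^^ k) v)" if "k < h v" for k v
  proof -
    have "(q ^^ k) v \<noteq> r" using h_iter[of k v] that h0[of "(q ^^ k) v"] by auto
    then show ?thesis using q(1) by simp
  qed
  have inj_iter: "inj_on (\<lambda>k. (q ^^ k) v) {..h v}" for v
  proof (rule inj_onI)
    fix j k assume "j \<in> {..h v}" "k \<in> {..h v}" "(q ^^ j) v = (q ^^ k) v"
    then show "j = k" using h_iter[of j v] h_iter[of k v] by auto
  qed
  have edge: "v \<noteq> r \<and> u = q v \<or> u \<noteq> r \<and> v = q u" if uv: "E u v" for u v
  proof (rule ccontr)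
    assume neg: "\<not> ?thesis"
    \<comment> \<open>By minimality of \<open>I\<close>, then of \<open>J\<close>, the chains from
      \<open>v\<close> and \<open>u\<close> cut at these indices share only their last
      vertex.\<close>
    define I where "I = (LEAST i. i \<le> h v \<and> (\<exists>j\<le>h u. (q ^^ i) v = (q ^^ j) u))"
    have ex: "\<exists>i. i \<le> h v \<and> (\<exists>j\<le>h u. (q ^^ i) v = (q ^^ j) u)"
      by (rule exI[of _ "h v"]) (use top in force)
    have I: "I \<le> h v" "\<exists>j\<le>h u. (q ^^ I) v = (q ^^ j) u"
      using LeastI_ex[OF ex, folded I_def] by simp_all
    have I_min: "(q ^^ i) v \<noteq> (q ^^ j) u" if "i < I" "j \<le> h u" for i j
      using not_less_Least[OF that(1)[unfolded I_def]] that I(1) by auto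
    define J where "J = (LEAST j. j \<le> h u \<and> (q ^^ I) v = (q ^^ j) u)"
    have J: "J \<le> h u" "(q ^^ I) v = (q ^^ J) u"
      using LeastI_ex[OF I(2), folded J_def] by simp_all
    have J_min: "(q ^^ I) v \<noteq> (q ^^ j) u" if "j < J" for j
      using not_less_Least[OF that[unfolded J_def]] that J(1) by auto
    \<comment> \<open>the two descending chains, joined at their first common vertex and closed by the edge \<open>u v\<close>\<close>
    define c where "c = map (\<lambda>k. (q ^^ k) v) [0..<Suc I] @ map (\<lambda>k. (q ^^ k) u) (rev [0..<J])"
    \<comment> \<open>With fewer steps the edge would be a loop or join a vertex to its
      parent.\<close>
    have "I + J \<ge> 2"
    proof (rule ccontr)
      assume "\<not> 2 \<le> I + J"
      then consider "I = 0" "J = 0" | "I = 1" "J = 0" | "I = 0" "J = 1" by linarith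
      then show False
      proof cases
        case 1 then show False using J uv irr by auto
      next
        case 2 then have "v \<noteq> r" using I(1) h0[of v] by auto
        with 2 J neg show False by auto
      next
        case 3 then have "u \<noteq> r" using J(1) h0[of u] by auto
        with 3 J neg show False by auto
      qed
    qed
    then have len: "3 \<le> length c" by (simp add: c_def)
    have "distinct (map (\<lambda>k. (q ^^ k) v) [0..<Suc I])"
      using I(1) by (auto simp: distinct_map simp del: upt_Suc intro!: inj_on_subset[OF inj_iter[of v]])
    moreover have "distinct (map (\<lambda>k. (q ^^ k) u) (rev [0..<J]))"
      using J(1) by (auto simp: distinct_map intro!: inj_on_subset[OF inj_iter[of u]])
    moreover have "(q ^^ i) v \<noteq> (q ^^ j) u" if "i \<le> I" "j < J" for i j
      using I_min[of i j] J_min[of j] that J(1) by (cases "i = I") auto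
    ultimately have dist: "distinct c"
      unfolding c_def by (auto simp del: upt_Suc simp: less_Suc_eq_le)
    have s1: "successively E (map (\<lambda>k. (q ^^ k) v) [0..<Suc I])"
      using I(1) by (auto simp: successively_conv_nth simp del: upt_Suc intro!: sym[OF E_iter, simplified])
    have s2: "successively E (map (\<lambda>k. (q ^^ k) u) (rev [0..<J]))"
      unfolding rev_map[symmetric] successively_rev
      using J(1) by (auto simp: successively_conv_nth intro!: E_iter[simplified])
    have "E ((q ^^ I) v) ((q ^^ (J - 1)) u)" if "J > 0"
      using E_iter[of "J - 1" u] that J by simp
    then have succ: "successively E c"
      unfolding c_def using s1 s2
      by (cases "J = 0") (auto simp: successively_append_iff last_map hd_map hd_rev last_upt simp del: upt_Suc)
    have hd: "hd c = v" by (simp add: c_def hd_append hd_map del: upt_Suc)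
    have "last c = u"
    proof (cases "J = 0")
      case True then show ?thesis using J by (simp add: c_def)
    next
      case False then show ?thesis by (simp add: c_def last_map last_rev)
    qed
    with len dist succ hd uv acyc[of c] show False by (simp add: is_cycle_def)
  qed
  have "E u v \<longleftrightarrow> v \<noteq> r \<and> u = q v \<or> u \<noteq> r \<and> v = q u" for u v
    using edge[of u v] q(1)[of u] q(1)[of v] sym by auto
  with h0 q(2) show ?thesis by (intro that[of h q])
qed

text \<open>The end is implicit in \<open>p\<close>: connectedness makes any two upward paths merge.
  Up to sign, \<open>lev\<close> is a Busemann function of that end.\<close>

locale ended_tree =
  fixes E :: "'v \<Rightarrow> 'v \<Rightarrow> bool" and p :: "'v \<Rightarrow> 'v" and lev :: "'v \<Rightarrow> int" and d :: nat
  assumes adj: "E u w \<longleftrightarrow> w = p u \<or> u = p w"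
    and lev_p: "lev (p v) = lev v + 1"
    and conn: "E\<^sup>*\<^sup>* u v"
    and finite_children: "finite {w. p w = v}"
    and card_children: "card {w. p w = v} = d"
    and d_ge2: "2 \<le> d"

text \<open>Every vertex has a child, so some ray leads away from an arbitrary root; its end becomes
  the target of the orientation.\<close>

lemma regular_tree_imp_ended_tree:
  fixes E :: "'v \<Rightarrow> 'v \<Rightarrow> bool"
  assumes "\<Delta> > 2" and reg: "regular_tree \<Delta> E"
  obtains p lev where "ended_tree E p lev (\<Delta> - 1)"
proof -
  fix r :: 'v
  have tree: "is_tree E" and deg: "finite {w. E v w}" "card {w. E v w} = \<Delta>" for v
    using reg by (auto simp: regular_tree_def)
  obtain q h where h0: "\<And>v. h v = 0 \<longleftrightarrow> v = r"
    and hS: "\<And>v. v \<noteq> r \<Longrightarrow> h v = Suc (h (q v))"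
    and Eq: "\<And>u v. E u v \<longleftrightarrow> v \<noteq> r \<and> u = q v \<or> u \<noteq> r \<and> v = q u"
    by (rule tree_rooted_parent[OF tree, of r]) blast
  \<comment> \<open>The value \<open>q r\<close> is unspecified, but discarding one of at least
    three neighbours does no harm at the root either.\<close>
  have "\<exists>w. w \<noteq> r \<and> q w = v" for v
  proof -
    have "\<not> {w. E v w} \<subseteq> {q v}"
      using card_mono[of "{q v}" "{w. E v w}"] deg[of v] assms(1) by auto
    then show ?thesis using Eq by blast
  qed
  then obtain s where s: "\<And>v. s v \<noteq> r" "\<And>v. q (s v) = v" by metis
  define ray where "ray n = (s ^^ n) r" for n
  have ray0: "ray 0 = r" and rayS: "ray (Suc n) = s (ray n)" for n
    by (simp_all add: ray_def)
  have h_ray: "h (ray n) = n" for n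
    by (induction n) (use h0 hS s in \<open>auto simp: ray0 rayS\<close>)
  \<comment> \<open>reverse the edges of a ray from \<open>r\<close>, so that all parents point to its end\<close>
  define p where "p v = (if v = ray (h v) then ray (Suc (h v)) else q v)" for v
  \<comment> \<open>The path from \<open>v\<close> to the root joins the ray after
    \<open>m v\<close> steps; the level is the index of the joining vertex on the ray, lowered by
    one for each of these steps.\<close>
  define m where "m v = (LEAST m. (q ^^ m) v \<in> range ray)" for v
  define lev where "lev v = int (h ((q ^^ m v) v)) - int (m v)" for v
  have on_ray: "v \<in> range ray \<longleftrightarrow> v = ray (h v)" for v
    using h_ray by (metis rangeE rangeI)
  have lev_ray: "lev (ray n) = int n" for n
  proof -
    have "m (ray n) = 0" unfolding m_def by (rule Least_eq_0) auto
    then show ?thesis by (simp add: lev_def h_ray)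
  qed
  have meets: "\<exists>k. (q ^^ k) v \<in> range ray" for v
  proof (induction "h v" arbitrary: v)
    case 0
    then have "(q ^^ 0) v = ray 0" using h0[of v] by (simp add: ray0)
    then show ?case by blast
  next
    case (Suc n)
    then have "n = h (q v)" using hS[of v] h0[of v] by auto
    then obtain k where "(q ^^ k) (q v) \<in> range ray" using Suc.hyps(1) by blast
    then have "(q ^^ Suc k) v \<in> range ray" by (simp add: funpow_swap1)
    then show ?case by blast
  qed
  have lev_p: "lev (p v) = lev v + 1" for v
  proof (cases "v = ray (h v)")
    case True
    then have "p v = ray (Suc (h v))" by (simp add: p_def)
    then show ?thesis using lev_ray[of "Suc (h v)"] lev_ray[of "h v"] True by simp
  next
    case False
    then have "(q ^^ 0) v \<notin> range ray" using on_ray by simp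
    moreover obtain k where "(q ^^ k) v \<in> range ray" using meets by blast
    ultimately have "m v = Suc (LEAST m. (q ^^ Suc m) v \<in> range ray)"
      unfolding m_def by (intro Least_Suc)
    also have "\<dots> = Suc (m (q v))" by (simp add: m_def funpow_swap1)
    finally have "m v = Suc (m (q v))" .
    then show ?thesis using False by (simp add: p_def lev_def funpow_swap1)
  qed
  have E_sym: "E u v \<longleftrightarrow> E v u" for u v using Eq by blast
  have E_p: "E v (p v)" for v
  proof (cases "v = ray (h v)")
    case True
    then have "p v = s v" by (metis p_def rayS)
    then show ?thesis using s by (simp add: Eq)
  next
    case False
    then have "v \<noteq> r" using h0 ray0 by metis
    then show ?thesis using False by (simp add: Eq p_def)
  qed
  have up: "w = p (q w) \<or> q w = p w" if "w \<noteq> r" for w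
  proof (cases "w = ray (h w)")
    case True
    have hw: "h w = Suc (h (q w))" using hS that by blast
    then have "q w = ray (h (q w))" using True s(2) rayS by metis
    then show ?thesis using True hw by (metis p_def)
  next
    case False
    then show ?thesis by (simp add: p_def)
  qed
  have adj: "E u w \<longleftrightarrow> w = p u \<or> u = p w" for u w
    using Eq[of u w] up E_p E_sym by metis
  have children: "{w. p w = v} = {w. E v w} - {p v}" for v
  proof -
    have "w \<noteq> p v" if "p w = v" for w using lev_p[of w] lev_p[of v] that by auto
    then show ?thesis using adj by auto
  qed
  have "ended_tree E p lev (\<Delta> - 1)"
  proof
    show "E\<^sup>*\<^sup>* u v" for u v using tree by (simp add: is_tree_def)
    show "card {w. p w = v} = \<Delta> - 1" for v
      using deg[of v] E_p[of v] by (simp add: children)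
    show "finite {w. p w = v}" for v using deg[of v] by (simp add: children)
  qed (use adj lev_p assms(1) in auto)
  then show ?thesis by (rule that)
qed

section \<open>The colouring\<close>

context ended_tree
begin

definition children :: "'v \<Rightarrow> 'v set" where
  "children v = {w. p w = v}"

text \<open>The bijection depends on \<open>p w\<close> only, so siblings share it and get distinct
  indices.\<close>

definition index :: "'v \<Rightarrow> nat" where
  "index w = (SOME f. bij_betw f (children (p w)) {..<d}) w"

text \<open>The bit at the parent's level shifts the siblings' weights from \<open>0..d-1\<close> to
  \<open>1..d\<close>. Colours do not enter, so \<open>colour\<close> can refer to weights without
  recursion.\<close>

definition weight :: "'v \<Rightarrow> nat" where
  "weight w = index w + of_bool (toeplitz (lev (p w)))"

definition missing :: "'v \<Rightarrow> nat" where
  "missing v = (if toeplitz (lev v) then 0 else d)"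

definition colour :: "'v \<Rightarrow> bool" where
  "colour w \<longleftrightarrow> index w < weight (p w)"

lemma in_children: "w \<in> children v \<longleftrightarrow> p w = v"
  by (simp add: children_def)

lemma finite_set_children: "finite (children v)"
  by (simp add: children_def finite_children)

lemma neighbours: "{w. E v w} = insert (p v) (children v)"
  by (auto simp: adj in_children)

lemma parent_not_child: "p v \<notin> children v"
  using lev_p[of v] lev_p[of "p v"] by (auto simp: in_children)

lemma bij_betw_index: "bij_betw index (children v) {..<d}"
proof -
  have "\<exists>f. bij_betw f (children v) {..<d}"
    using finite_same_card_bij[of "children v" "{..<d}"] finite_set_children card_children
    by (simp add: children_def)
  then have "bij_betw (SOME f. bij_betw f (children v) {..<d}) (children v) {..<d}"
    by (rule someI_ex)
  moreover have "index w = (SOME f. bij_betw f (children v) {..<d}) w" if "w \<in> children v" for w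
    using that by (simp add: index_def in_children)
  ultimately show ?thesis
    using bij_betw_cong[of "children v" index] by blast
qed

lemma index_less: "index w < d"
  using bij_betwE[OF bij_betw_index[of "p w"]] by (auto simp: in_children)

lemma weight_le: "weight w \<le> d"
  using index_less[of w] by (simp add: weight_def)

lemma inj_on_weight: "inj_on weight (children v)"
  using bij_betw_imp_inj_on[OF bij_betw_index[of v]]
  by (auto simp: inj_on_def weight_def in_children)

lemma weight_image: "weight ` children v = {..d} - {missing v}"
proof -
  have "weight ` children v = (\<lambda>i. i + of_bool (toeplitz (lev v))) ` index ` children v"
    unfolding image_image by (intro image_cong) (auto simp: weight_def in_children)
  also have "index ` children v = {..<d}"
    using bij_betw_index[of v] by (simp add: bij_betw_def)
  also have "(\<lambda>i. i + of_bool (toeplitz (lev v))) ` {..<d} = {..d} - {missing v}"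
  proof (cases "toeplitz (lev v)")
    case True
    then have "(\<lambda>i. i + of_bool (toeplitz (lev v))) ` {..<d} = Suc ` {..<d}" by simp
    also have "\<dots> = {..d} - {0}" by (auto simp: image_Suc_lessThan)
    finally show ?thesis using True by (simp add: missing_def)
  next
    case False
    then show ?thesis by (auto simp: missing_def)
  qed
  finally show ?thesis .
qed

lemma missing_le: "missing v \<le> d"
  by (simp add: missing_def)

lemma missing_eq_iff: "missing v = missing w \<longleftrightarrow> toeplitz (lev v) = toeplitz (lev w)"
  using d_ge2 by (simp add: missing_def)

lemma card_coloured_children: "card {w \<in> children v. colour w} = weight v"
proof -
  have "index ` {w \<in> children v. colour w} = {i \<in> index ` children v. i < weight v}"
    by (auto simp: colour_def in_children)
  also have "\<dots> = {..<weight v}"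
    using bij_betw_index[of v] weight_le[of v] by (auto simp: bij_betw_def)
  finally have "card (index ` {w \<in> children v. colour w}) = weight v" by simp
  moreover have "inj_on index {w \<in> children v. colour w}"
    using bij_betw_imp_inj_on[OF bij_betw_index[of v]] by (rule inj_on_subset) auto
  ultimately show ?thesis by (simp add: card_image)
qed

lemma card_coloured_neighbours:
  "card {w. E v w \<and> colour w} = weight v + of_bool (colour (p v))"
proof -
  have "{w. E v w \<and> colour w} =
      {w \<in> children v. colour w} \<union> (if colour (p v) then {p v} else {})"
    using neighbours[of v] by (auto simp: set_eq_iff)
  then show ?thesis
    using parent_not_child[of v] finite_set_children[of v]
    by (auto simp: card_coloured_children card_insert_if)
qed

section \<open>What an automorphism preserving colours on a ball must preserve\<close>

definition preserved :: "('v \<Rightarrow> 'v) \<Rightarrow> 'v \<Rightarrow> nat \<Rightarrow> bool" where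
  "preserved g w R \<longleftrightarrow> (\<forall>n\<le>R. \<forall>z. (E ^^ n) w z \<longrightarrow> colour (g z) = colour z)"

lemma preserved_mono: "preserved g w R \<Longrightarrow> S \<le> R \<Longrightarrow> preserved g w S"
  unfolding preserved_def by (meson order_trans)

lemma preserved_self: "preserved g w R \<Longrightarrow> colour (g w) = colour w"
  unfolding preserved_def by (metis le0 relpowp_0_I)

lemma preserved_step:
  assumes "preserved g w (Suc R)" and "E w z"
  shows "preserved g z R"
  unfolding preserved_def
proof (intro allI impI)
  fix n y assume "n \<le> R" "(E ^^ n) z y"
  with assms(2) have "(E ^^ Suc n) w y" by (blast intro: relpowp_Suc_I2)
  with assms(1) \<open>n \<le> R\<close> show "colour (g y) = colour y" unfolding preserved_def by blast
qed

lemma preserved_child: "preserved g w (Suc R) \<Longrightarrow> z \<in> children w \<Longrightarrow> preserved g z R"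
  by (rule preserved_step) (auto simp: adj in_children)

lemma preserved_ancestor: "preserved g w (k + R) \<Longrightarrow> preserved g ((p ^^ k) w) R"
proof (induction k arbitrary: R)
  case (Suc k)
  have "preserved g ((p ^^ k) w) (Suc R)" using Suc by simp
  moreover have "E ((p ^^ k) w) (p ((p ^^ k) w))" by (simp only: adj simp_thms)
  ultimately have "preserved g (p ((p ^^ k) w)) R" by (rule preserved_step)
  then show ?case by simp
qed simp

definition oriented :: "('v \<Rightarrow> 'v) \<Rightarrow> 'v \<Rightarrow> bool" where
  "oriented g w \<longleftrightarrow> g (p w) = p (g w)"

lemma Aut_neighbours:
  assumes "g \<in> Aut E"
  shows "g ` {w. E v w} = {w. E (g v) w}"
proof -
  have "w \<in> g ` {w. E v w}" if "E (g v) w" for w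
  proof -
    have "surj g" using assms by (simp add: Aut_def bij_def)
    then obtain z where "w = g z" by (rule surjE)
    with that assms show ?thesis by (auto simp: Aut_def)
  qed
  then show ?thesis using assms by (auto simp: Aut_def)
qed

lemma Aut_inj: "g \<in> Aut E \<Longrightarrow> inj_on g A"
  by (auto simp: Aut_def bij_def intro: inj_on_subset)

lemma oriented_children:
  assumes "g \<in> Aut E" and "oriented g w"
  shows "g ` children w = children (g w)"
proof -
  have ch: "children v = {w. E v w} - {p v}" for v
    using neighbours[of v] parent_not_child[of v] by auto
  have "g ` children w = g ` {z. E w z} - {g (p w)}"
    unfolding ch using Aut_inj[OF assms(1)] by (simp add: image_set_diff)
  then show ?thesis
    using assms(2) by (simp add: Aut_neighbours[OF assms(1)] oriented_def ch)
qed

lemma oriented_child: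
  assumes "g \<in> Aut E" and "oriented g w" and "z \<in> children w"
  shows "oriented g z"
proof -
  have "g z \<in> children (g w)" using oriented_children[OF assms(1,2)] assms(3) by blast
  with assms(3) show ?thesis by (simp add: oriented_def in_children)
qed

text \<open>Read contrapositively: a failure of orientation passes to all ancestors.\<close>

lemma oriented_of_parent: "g \<in> Aut E \<Longrightarrow> oriented g (p w) \<Longrightarrow> oriented g w"
  by (rule oriented_child) (simp_all add: in_children)

text \<open>The weight counts coloured children, and orientation ensures that children go to
  children.\<close>

lemma oriented_weight:
  assumes g: "g \<in> Aut E" and o: "oriented g w" and pr: "preserved g w 1"
  shows "weight (g w) = weight w"
proof -
  have "colour (g z) = colour z" if "z \<in> children w" for z
    using preserved_self preserved_child[of g w 0 z] pr that by simp
  then have "{z \<in> children (g w). colour z} = g ` {z \<in> children w. colour z}"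
    unfolding oriented_children[OF g o, symmetric] by auto
  then show ?thesis
    using card_coloured_children Aut_inj[OF g] by (metis card_image)
qed

lemma oriented_missing:
  assumes g: "g \<in> Aut E" and o: "oriented g w" and pr: "preserved g w 2"
  shows "missing (g w) = missing w"
proof -
  have "weight (g z) = weight z" if "z \<in> children w" for z
    using oriented_weight[OF g oriented_child[OF g o that]] preserved_child[of g w 1 z] pr that
    by (simp add: numeral_2_eq_2)
  then have "weight ` children (g w) = weight ` children w"
    unfolding oriented_children[OF g o, symmetric] by (simp add: image_image)
  then show ?thesis
    unfolding weight_image using missing_le by (auto simp: set_eq_iff)
qed

text \<open>The number of coloured neighbours is invariant even without orientation, so the weights
  of a vertex and its image differ by at most one.\<close>

lemma neighbour_count:
  assumes g: "g \<in> Aut E" and pr: "preserved g w 1"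
  shows "weight (g w) + of_bool (colour (p (g w))) = weight w + of_bool (colour (p w))"
proof -
  have "colour (g z) = colour z" if "E w z" for z
    using preserved_self preserved_step[of g w 0 z] pr that by simp
  then have "g ` {z. E w z \<and> colour z} = {z \<in> g ` {z. E w z}. colour z}"
    by auto
  then have "{z. E (g w) z \<and> colour z} = g ` {z. E w z \<and> colour z}"
    unfolding Aut_neighbours[OF g] by simp
  then show ?thesis
    using card_coloured_neighbours Aut_inj[OF g] by (metis card_image)
qed

lemma unoriented_parent:
  assumes "g \<in> Aut E" and "\<not> oriented g w"
  shows "p (g (p w)) = g w"
proof -
  have "E (g w) (g (p w))" using assms(1) adj[of w "p w"] by (simp add: Aut_def)
  with assms(2) show ?thesis using adj[of "g w" "g (p w)"] by (auto simp: oriented_def)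
qed

text \<open>
  An automorphism that is not oriented at \<open>w\<close> maps the upward path from \<open>w\<close> to a downward path but is
  oriented at all vertices hanging off this path, so it preserves their weights.
\<close>

lemma unoriented_step:
  assumes g: "g \<in> Aut E" and u: "\<not> oriented g w" and pr: "preserved g (p w) 2"
  shows "{missing (p w), weight w} = {missing (g (p w)), weight (g (p (p w)))}"
proof -
  let ?a = "p w"
  have pb: "p (g ?a) = g w" using unoriented_parent[OF g u] .
  have u': "\<not> oriented g ?a" using oriented_of_parent[OF g] u by blast
  then have pb': "p (g (p ?a)) = g ?a" using unoriented_parent[OF g] by blast
  have w: "w \<in> children ?a" and b: "g (p ?a) \<in> children (g ?a)"
    using pb' by (simp_all add: in_children)
  \<comment> \<open>The children of \<open>?a\<close> off the path are matched with the children of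
    \<open>g ?a\<close> off the image path, which goes down through \<open>g (p ?a)\<close>.\<close>
  have "g ` (children ?a - {w}) = g ` ({z. E ?a z} - {p ?a, w})"
    using parent_not_child[of ?a] by (auto simp: neighbours)
  also have "\<dots> = {z. E (g ?a) z} - {g (p ?a), g w}"
    using Aut_inj[OF g] by (simp add: image_set_diff Aut_neighbours[OF g])
  also have "\<dots> = children (g ?a) - {g (p ?a)}"
    unfolding neighbours pb using parent_not_child[of "g ?a"] pb by auto
  finally have im: "g ` (children ?a - {w}) = children (g ?a) - {g (p ?a)}" .
  have wt: "weight (g z) = weight z" if "z \<in> children ?a - {w}" for z
  proof (rule oriented_weight[OF g])
    have "g z \<in> children (g ?a)" using im that by blast
    with that show "oriented g z" by (simp add: oriented_def in_children)
    show "preserved g z 1"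
      using preserved_child[of g ?a 1 z] pr that by (simp add: numeral_2_eq_2)
  qed
  have "weight ` (children ?a - {w}) = {..d} - {missing ?a, weight w}"
    using inj_on_weight[of ?a] w by (auto simp: inj_on_image_set_diff weight_image)
  moreover have "weight ` (children (g ?a) - {g (p ?a)}) =
      {..d} - {missing (g ?a), weight (g (p ?a))}"
    using inj_on_weight[of "g ?a"] b by (auto simp: inj_on_image_set_diff weight_image)
  moreover have "weight ` (children (g ?a) - {g (p ?a)}) = weight ` (children ?a - {w})"
    unfolding im[symmetric] image_image using wt by (intro image_cong) auto
  ultimately have "{..d} - {missing ?a, weight w} = {..d} - {missing (g ?a), weight (g (p ?a))}"
    by simp
  moreover have "{missing ?a, weight w} \<subseteq> {..d}" "{missing (g ?a), weight (g (p ?a))} \<subseteq> {..d}"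
    using missing_le weight_le by auto
  ultimately show ?thesis by (metis double_diff order_refl)
qed

section \<open>Rigidity of the colouring\<close>

lemma lev_ancestor: "lev ((p ^^ k) v) = lev v + int k"
  by (induction k) (auto simp: lev_p)

text \<open>Reversing the upward path from \<open>w\<close> would pair the bits above
  \<open>w\<close> with bits at descending levels, against the reflection property. Radius 20 leaves
  room for the ancestors up to \<open>i + 3 \<le> 17\<close> with balls of radius 2.\<close>

lemma preserved_imp_oriented:
  assumes g: "g \<in> Aut E" and pr: "preserved g w 20"
  shows "oriented g w"
proof (rule ccontr)
  assume u: "\<not> oriented g w"
  define a where "a k = (p ^^ k) w" for k
  define b where "b k = g (a k)" for k
  have aS: "a (Suc k) = p (a k)" for k by (simp add: a_def)
  have un: "\<not> oriented g (a k)" for k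
    by (induction k) (use u oriented_of_parent[OF g] in \<open>auto simp: a_def\<close>)
  have pb: "p (b (Suc k)) = b k" for k
    using unoriented_parent[OF g un[of k]] by (simp add: b_def aS)
  have leva: "lev (a k) = lev w + int k" for k
    by (simp add: a_def lev_ancestor)
  have levb: "lev (b k) = lev (g w) - int k" for k
  proof (induction k)
    case (Suc k)
    then show ?case using lev_p[of "b (Suc k)"] pb[of k] by simp
  qed (simp add: b_def a_def)
  have pra: "preserved g (a k) 2" if "k \<le> 18" for k
    unfolding a_def by (rule preserved_ancestor, rule preserved_mono[OF pr]) (use that in simp)
  obtain i :: nat where i: "i \<le> 14"
    "toeplitz (lev w + 1 + int i) = toeplitz (lev w + 1 + int i + 2)"
    "toeplitz (lev (g w) - 1 - int i) = toeplitz (lev (g w) - 1 - int i - 2)"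
    "toeplitz (lev w + 1 + int i) \<noteq> toeplitz (lev (g w) - 1 - int i)"
    using toeplitz_breaks_reflection[of "lev w + 1" "lev (g w) - 1"] by blast
  have m: "missing (a (i + 3)) = missing (a (i + 1))" "missing (b (i + 3)) = missing (b (i + 1))"
      "missing (a (i + 1)) \<noteq> missing (b (i + 1))"
    unfolding missing_eq_iff leva levb using i by (simp_all add: algebra_simps)
  have step: "{missing (a (k + 1)), weight (a k)} = {missing (b (k + 1)), weight (b (k + 2))}"
    if "k \<le> 17" for k
    using unoriented_step[OF g un[of k]] pra[of "Suc k"] that by (simp add: b_def aS)
  \<comment> \<open>Equal pairs whose first entries differ must match crosswise. Steps
    \<open>i\<close> and \<open>i + 2\<close> thus give the weights of \<open>b (i + 2)\<close> and
    of its preimage \<open>a (i + 2)\<close>.\<close>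
  have "weight (b (i + 2)) = missing (a (i + 1))"
    using step[of i] i(1) m(3) by (auto simp: doubleton_eq_iff)
  moreover have "weight (a (i + 2)) = missing (b (i + 1))"
    using step[of "i + 2"] i(1) m by (auto simp: doubleton_eq_iff numeral_3_eq_3)
  moreover have "weight (b (i + 2)) + of_bool (colour (p (b (i + 2)))) =
      weight (a (i + 2)) + of_bool (colour (p (a (i + 2))))"
    using neighbour_count[OF g, of "a (i + 2)"] preserved_mono[OF pra[of "i + 2"]] i(1)
    by (simp add: b_def)
  \<comment> \<open>these weights are \<open>0\<close> and \<open>d\<close>, but they differ by at most one\<close>
  ultimately show False
    using m(3) d_ge2 by (auto simp: missing_def of_bool_def split: if_splits)
qed

text \<open>Each edge of the walk lengthens at most one of the two upward paths; the bound
  \<open>n\<close> leaves finitely many level shifts to exclude.\<close>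

lemma walk_imp_common_ancestor:
  "(E ^^ n) u v \<Longrightarrow> \<exists>i\<le>n. \<exists>j\<le>n. (p ^^ i) u = (p ^^ j) v"
proof (induction n arbitrary: v)
  case 0
  then show ?case by auto
next
  case (Suc n)
  then obtain w where w: "(E ^^ n) u w" "E w v" by auto
  then obtain i j where ij: "i \<le> n" "j \<le> n" "(p ^^ i) u = (p ^^ j) w" using Suc.IH by blast
  from w(2) consider "v = p w" | "w = p v" by (auto simp: adj)
  then show ?case
  proof cases
    case 1
    have "(p ^^ Suc i) u = (p ^^ j) v" using ij(3) 1 by (simp add: funpow_swap1)
    with ij show ?thesis by (intro exI[of _ "Suc i"] conjI exI[of _ j]) auto
  next
    case 2
    have "(p ^^ i) u = (p ^^ Suc j) v" using ij(3) 2 by (simp add: funpow_swap1)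
    with ij show ?thesis by (intro exI[of _ i] conjI exI[of _ "Suc j"]) auto
  qed
qed

text \<open>On a large ball \<open>g\<close> respects parents, so it carries bits upward from
  \<open>u\<close> to bits shifted by the level change, which must be \<open>0\<close>. Then a
  common ancestor is fixed, and distinct sibling weights propagate this down to
  \<open>u\<close>.\<close>

lemma colour_rigid:
  "\<exists>D. \<forall>g \<in> Aut E. \<forall>u. (E ^^ n) u (g u) \<longrightarrow> preserved g u D \<longrightarrow> g u = u"
proof -
  have "\<exists>L::nat. \<forall>m. \<exists>i\<le>L. toeplitz (m + int i) \<noteq> toeplitz (m + int i + k)" if "k \<noteq> 0" for k
    using toeplitz_breaks_shift[OF that] .
  then obtain L :: "int \<Rightarrow> nat" where L: "\<And>k m. k \<noteq> 0 \<Longrightarrow>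
      \<exists>i\<le>L k. toeplitz (m + int i) \<noteq> toeplitz (m + int i + k)"
    by metis
  \<comment> \<open>The sum dominates \<open>L k\<close> for every possible level change at once;
    the summand \<open>n\<close> reaches the common ancestor.\<close>
  define M where "M = n + (\<Sum>k\<in>{-int n..int n}. L k)"
  have "g u = u" if g: "g \<in> Aut E" and walk: "(E ^^ n) u (g u)" and pr: "preserved g u (M + 20)" for g u
  proof -
    have pra: "preserved g ((p ^^ k) u) 20" if "k \<le> M" for k
      by (rule preserved_ancestor, rule preserved_mono[OF pr]) (use that in simp)
    have or: "oriented g ((p ^^ k) u)" if "k \<le> M" for k
      using preserved_imp_oriented[OF g pra[OF that]] .
    have gp: "g ((p ^^ k) u) = (p ^^ k) (g u)" if "k \<le> M" for k
      using that
    proof (induction k)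
      case (Suc k)
      then show ?case using or[of k] by (simp add: oriented_def)
    qed simp
    obtain i j where ij: "i \<le> n" "j \<le> n" "(p ^^ i) u = (p ^^ j) (g u)"
      using walk_imp_common_ancestor[OF walk] by blast
    define k where "k = int i - int j"
    have lv: "lev (g u) = lev u + k"
      using arg_cong[OF ij(3), of lev] by (simp add: lev_ancestor k_def)
    have "k = 0"
    proof (rule ccontr)
      assume "k \<noteq> 0"
      then obtain s where s: "s \<le> L k" "toeplitz (lev u + int s) \<noteq> toeplitz (lev u + int s + k)"
        using L by blast
      have "k \<in> {-int n..int n}" using ij(1,2) by (auto simp: k_def)
      then have "L k \<le> (\<Sum>k\<in>{-int n..int n}. L k)" by (intro member_le_sum) auto
      then have "s \<le> M" using s(1) by (simp add: M_def)
      then have "missing (g ((p ^^ s) u)) = missing ((p ^^ s) u)"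
        using oriented_missing[OF g or preserved_mono[OF pra]] by simp
      with s(2) show False
        using gp[OF \<open>s \<le> M\<close>] by (simp add: missing_eq_iff lev_ancestor lv algebra_simps)
    qed
    then have "i = j" by (simp add: k_def)
    have iM: "i \<le> M" using ij(1) by (simp add: M_def)
    have "g ((p ^^ i) u) = (p ^^ i) u" using gp[OF iM] ij(3) \<open>i = j\<close> by simp
    \<comment> \<open>One step of the descent: below a fixed vertex, equal weights force equal
      children.\<close>
    moreover have "g ((p ^^ m) u) = (p ^^ m) u"
      if "m < M" "g ((p ^^ Suc m) u) = (p ^^ Suc m) u" for m
    proof (rule inj_onD[OF inj_on_weight[of "(p ^^ Suc m) u"]])
      show "weight (g ((p ^^ m) u)) = weight ((p ^^ m) u)"
        using that(1) by (intro oriented_weight[OF g or preserved_mono[OF pra]]) auto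
      show "(p ^^ m) u \<in> children ((p ^^ Suc m) u)" by (simp add: in_children)
      show "g ((p ^^ m) u) \<in> children ((p ^^ Suc m) u)"
        using or[of m] that by (simp add: in_children oriented_def)
    qed
    ultimately have "g ((p ^^ 0) u) = (p ^^ 0) u"
      using iM by (induction i) auto
    then show ?thesis by simp
  qed
  then show ?thesis by (intro exI[of _ "M + 20"] ballI allI impI)
qed

end

section \<open>Orbit closures\<close>

lemma id_in_Aut: "id \<in> Aut E"
  by (simp add: Aut_def)

lemma comp_in_Aut: "g \<in> Aut E \<Longrightarrow> h \<in> Aut E \<Longrightarrow> g \<circ> h \<in> Aut E"
  by (auto simp: Aut_def bij_comp)

lemma inv_in_Aut:
  assumes "g \<in> Aut E"
  shows "inv g \<in> Aut E"
proof -
  have g: "bij g" "\<And>u v. E (g u) (g v) \<longleftrightarrow> E u v" using assms by (auto simp: Aut_def)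
  have "E (inv g u) (inv g v) \<longleftrightarrow> E u v" for u v
    using g(2)[of "inv g u" "inv g v"] g(1) by (simp add: bij_is_surj surj_f_inv_f)
  with g(1) show ?thesis by (simp add: Aut_def bij_imp_bij_inv)
qed

lemma act_comp: "bij g \<Longrightarrow> bij h \<Longrightarrow> act g (act h x) = act (g \<circ> h) x"
  by (simp add: act_def o_inv_distrib fun_eq_iff)

lemma act_id: "act id x = x"
  by (simp add: act_def)

lemma act_inv_act: "bij g \<Longrightarrow> act (inv g) (act g x) = x"
  by (simp add: act_comp bij_imp_bij_inv act_id inv_o_cancel bij_is_inj)

lemma bij_Aut: "g \<in> Aut E \<Longrightarrow> bij g"
  by (simp add: Aut_def)

lemma equiv_orbit_rel: "equiv UNIV (orbit_rel E r)"
proof (rule equivI)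
  show "refl (orbit_rel E r)"
    by (auto simp: refl_on_def orbit_rel_def Aut_stab_def intro!: bexI[of _ id] id_in_Aut simp: act_id)
  show "sym (orbit_rel E r)"
  proof (rule symI)
    fix x y assume "(x, y) \<in> orbit_rel E r"
    then obtain g where g: "g \<in> Aut E" "g r = r" "y = act g x"
      by (auto simp: orbit_rel_def Aut_stab_def)
    then have "inv g \<in> Aut_stab E r"
      using inv_in_Aut[OF g(1)] bij_inv_eq_iff[OF bij_Aut[OF g(1)], of r r] by (auto simp: Aut_stab_def)
    moreover have "x = act (inv g) y" using g act_inv_act bij_Aut by metis
    ultimately show "(y, x) \<in> orbit_rel E r" unfolding orbit_rel_def by blast
  qed
  show "trans (orbit_rel E r)"
  proof (rule transI)
    fix x y z assume "(x, y) \<in> orbit_rel E r" "(y, z) \<in> orbit_rel E r"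
    then obtain g h where "g \<in> Aut_stab E r" "y = act g x" "h \<in> Aut_stab E r" "z = act h y"
      by (auto simp: orbit_rel_def)
    then have "h \<circ> g \<in> Aut_stab E r" "z = act (h \<circ> g) x"
      using comp_in_Aut by (auto simp: Aut_stab_def act_comp bij_Aut)
    then show "(x, z) \<in> orbit_rel E r" unfolding orbit_rel_def by blast
  qed
qed auto

section \<open>Cylinders and components in the quotient\<close>

lemma topspace_config_topology: "topspace config_topology = UNIV"
  by (simp add: config_topology_def)

text \<open>The reindexing \<open>f\<close> provides for translates of a cylinder by
  automorphisms.\<close>

lemma openin_config_cylinder:
  assumes "finite F"
  shows "openin config_topology {z. \<forall>w\<in>F. z (f w) = y w}"
  using assms
proof induction
  case empty
  then show ?case using openin_topspace[of config_topology] by (simp add: topspace_config_topology)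
next
  case (insert w F)
  have "continuous_map config_topology (discrete_topology UNIV) (\<lambda>z. z (f w))"
    unfolding config_topology_def by (rule continuous_map_product_projection) simp
  then have "openin config_topology {z \<in> topspace config_topology. z (f w) \<in> {y w}}"
    by (rule openin_continuous_map_preimage) simp
  then have "openin config_topology ({z. z (f w) = y w} \<inter> {z. \<forall>w\<in>F. z (f w) = y w})"
    using insert.IH by (intro openin_Int) (simp_all add: topspace_config_topology)
  moreover have "{z. z (f w) = y w} \<inter> {z. \<forall>w\<in>F. z (f w) = y w} = {z. \<forall>w\<in>insert w F. z (f w) = y w}"
    by auto
  ultimately show ?case by simp
qed

text \<open>The preimage in the configuration space is a union of translates of a cylinder over the
  root stabilizer.\<close>

lemma openin_quot_cylinder:
  assumes "finite F"
  shows "openin (config_quot_topology E r)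
    {Z \<in> config_quot E r. \<exists>z\<in>Z. \<forall>w\<in>F. z w = y w}" (is "openin _ ?U")
proof -
  let ?R = "orbit_rel E r"
  have "{z. ?R `` {z} \<in> ?U} = (\<Union>g\<in>Aut_stab E r. {z. \<forall>w\<in>F. z (inv g w) = y w})"
    by (auto simp: config_quot_def quotient_def orbit_rel_def act_def Image_singleton)
  moreover have "openin config_topology (\<Union>g\<in>Aut_stab E r. {z. \<forall>w\<in>F. z (inv g w) = y w})"
    by (intro openin_clauses(3)) (use openin_config_cylinder[OF assms] in blast)
  ultimately have "openin config_topology {z. ?R `` {z} \<in> ?U}" by simp
  then show ?thesis
    unfolding config_quot_topology_def openin_quotient_topology
    by (auto simp: topspace_config_topology config_quot_def)
qed

lemma topspace_config_quot_topology:
  "topspace (config_quot_topology E r) \<subseteq> config_quot E r"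
  using openin_topspace[of "config_quot_topology E r"]
  unfolding config_quot_topology_def openin_quotient_topology
  by (simp add: topspace_config_topology config_quot_def)

lemma config_quot_subset_orbit:
  assumes "Z \<in> config_quot E r" and "z \<in> Z" and "z = act h x" and "h \<in> Aut E"
  shows "Z \<subseteq> (\<lambda>h. act h x) ` Aut E"
proof
  fix z' assume "z' \<in> Z"
  with assms(1,2) have "(z, z') \<in> orbit_rel E r"
    unfolding config_quot_def by (metis equiv_orbit_rel quotient_eq_iff)
  then obtain g where "g \<in> Aut E" "z' = act g z" by (auto simp: orbit_rel_def Aut_stab_def)
  with assms(3,4) have "g \<circ> h \<in> Aut E" "z' = act (g \<circ> h) x"
    using comp_in_Aut by (auto simp: act_comp bij_Aut)
  then show "z' \<in> (\<lambda>h. act h x) ` Aut E" by blast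
qed

lemma config_quot_nonempty: "Z \<in> config_quot E r \<Longrightarrow> Z \<noteq> {}"
  unfolding config_quot_def by (rule in_quotient_imp_non_empty[OF equiv_orbit_rel])

text \<open>The disjunction serves \<open>equivclp\<close>, which follows edges in both
  directions.\<close>

lemma adj_G_orbit:
  assumes "adj_G E r Y Z" and "Y \<subseteq> (\<lambda>h. act h x) ` Aut E \<or> Z \<subseteq> (\<lambda>h. act h x) ` Aut E"
  shows "Y \<subseteq> (\<lambda>h. act h x) ` Aut E \<and> Z \<subseteq> (\<lambda>h. act h x) ` Aut E"
proof -
  have YZ: "Y \<in> config_quot E r" "Z \<in> config_quot E r" using assms(1) by (auto simp: adj_G_def)
  obtain y where y: "y \<in> Y" using config_quot_nonempty[OF YZ(1)] by blast
  then obtain g where g: "g \<in> Aut E" "act g y \<in> Z" using assms(1) by (auto simp: adj_G_def)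
  have "\<exists>h\<in>Aut E. y = act h x"
    using assms(2)
  proof
    assume "Z \<subseteq> (\<lambda>h. act h x) ` Aut E"
    then obtain h where h: "h \<in> Aut E" "act g y = act h x" using g(2) by blast
    have "y = act (inv g) (act g y)" by (simp only: act_inv_act[OF bij_Aut[OF g(1)]])
    also have "\<dots> = act (inv g \<circ> h) x"
      unfolding h(2) using act_comp bij_imp_bij_inv bij_Aut g(1) h(1) by metis
    finally have "y = act (inv g \<circ> h) x" .
    then show ?thesis using comp_in_Aut[OF inv_in_Aut[OF g(1)] h(1)] by blast
  qed (use y in blast)
  then obtain h where h: "h \<in> Aut E" "y = act h x" by blast
  have "act g y = act (g \<circ> h) x" using g h by (simp add: act_comp bij_Aut)
  then show ?thesis
    using config_quot_subset_orbit[OF YZ(1) y h(2,1)]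
      config_quot_subset_orbit[OF YZ(2) g(2) _ comp_in_Aut[OF g(1) h(1)]] by blast
qed

lemma component_T_orbit:
  assumes "Y \<in> component_T E r (orbit_rel E r `` {x})"
  shows "Y \<subseteq> (\<lambda>h. act h x) ` Aut E"
proof -
  have "equivclp (adj_T E r) (orbit_rel E r `` {x}) Y" using assms by (simp add: component_T_def)
  then show ?thesis
  proof (induction rule: equivclp_induct)
    case base
    then show ?case by (auto simp: orbit_rel_def Aut_stab_def)
  next
    case (step Y Z)
    then show ?case using adj_G_orbit[of E r Y Z x] adj_G_orbit[of E r Z Y x] by (auto simp: adj_T_def)
  qed
qed

section \<open>Limits of the orbit of a rigid configuration\<close>

lemma finite_walks:
  fixes E :: "'v \<Rightarrow> 'v \<Rightarrow> bool"
  assumes "\<And>v. finite {w. E v w}"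
  shows "finite {w. (E ^^ n) v w}"
proof (induction n)
  case (Suc n)
  have "{w. (E ^^ Suc n) v w} = (\<Union>u\<in>{u. (E ^^ n) v u}. {w. E u w})" by auto
  with Suc assms show ?case by simp
qed simp

lemma Aut_walk:
  assumes "g \<in> Aut E" and "(E ^^ n) u v"
  shows "(E ^^ n) (g u) (g v)"
  using assms(2)
proof (induction n arbitrary: v)
  case (Suc n)
  then obtain w where w: "(E ^^ n) u w" "E w v" by auto
  then have "(E ^^ n) (g u) (g w)" "E (g w) (g v)" using Suc.IH assms(1) by (auto simp: Aut_def)
  then show ?case by auto
qed simp

text \<open>The assumption \<open>lim\<close> places \<open>y\<close> in the closure of the orbit of
  \<open>x\<close>. A symmetry of \<open>y\<close> is seen by a translate of \<open>x\<close> on a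
  finite window, where rigidity excludes it.\<close>

lemma orbit_limit_Free:
  assumes conn: "\<And>u v. E\<^sup>*\<^sup>* u v" and fin: "\<And>v. finite {w. E v w}"
    and rigid: "\<And>n. \<exists>D. \<forall>g \<in> Aut E. \<forall>u. (E ^^ n) u (g u) \<longrightarrow>
        (\<forall>m\<le>D. \<forall>z. (E ^^ m) u z \<longrightarrow> x (g z) = x z) \<longrightarrow> g u = u"
    and lim: "\<And>F. finite F \<Longrightarrow> \<exists>h\<in>Aut E. \<forall>w\<in>F. act h x w = y w"
  shows "y \<in> Free E"
  unfolding Free_def
proof (intro CollectI ballI impI notI)
  fix g assume g: "g \<in> Aut E" "g \<noteq> id" "act g y = y"
  have yg: "y (g w) = y w" for w
    using fun_cong[OF g(3), of "g w"] bij_Aut[OF g(1)] by (simp add: act_def bij_is_inj)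
  obtain u where u: "g u \<noteq> u" using g(2) by (auto simp: fun_eq_iff)
  obtain n where n: "(E ^^ n) u (g u)" using rtranclp_imp_relpowp[OF conn] by blast
  obtain D where D: "\<And>k v. k \<in> Aut E \<Longrightarrow> (E ^^ n) v (k v) \<Longrightarrow>
      (\<And>m z. m \<le> D \<Longrightarrow> (E ^^ m) v z \<Longrightarrow> x (k z) = x z) \<Longrightarrow> k v = v"
    using rigid[of n] by blast
  define B where "B = (\<Union>m\<le>D. {w. (E ^^ m) u w})"
  have "finite (B \<union> g ` B)" unfolding B_def using finite_walks[OF fin] by auto
  then obtain h where h: "h \<in> Aut E" "\<forall>w\<in>B \<union> g ` B. act h x w = y w" using lim by blast
  have hb: "inv h (h w) = w" "h (inv h w) = w" for w
    using bij_Aut[OF h(1)] by (simp_all add: bij_is_inj bij_is_surj surj_f_inv_f)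
  \<comment> \<open>Conjugation carries the symmetry from the translate \<open>act h x\<close> back
    to \<open>x\<close>; it keeps the displacement \<open>n\<close>, so \<open>D\<close> can be
    fixed before \<open>h\<close>.\<close>
  define k where "k = inv h \<circ> g \<circ> h"
  have "k (inv h u) = inv h u"
  proof (rule D)
    show "k \<in> Aut E" unfolding k_def using g(1) h(1) by (intro comp_in_Aut inv_in_Aut)
    show "(E ^^ n) (inv h u) (k (inv h u))"
      using Aut_walk[OF inv_in_Aut[OF h(1)] n] by (simp add: k_def hb)
    fix m z assume m: "m \<le> D" "(E ^^ m) (inv h u) z"
    then have "h z \<in> B" using Aut_walk[OF h(1) m(2)] by (auto simp: B_def hb)
    then have "act h x (h z) = y (h z)" "act h x (g (h z)) = y (g (h z))" using h(2) by auto
    then show "x (k z) = x z" by (simp add: act_def hb k_def yg)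
  qed
  then have "h (inv h (g u)) = h (inv h u)" by (simp add: k_def hb)
  with u show False by (simp add: hb)
qed

lemma hyperaperiodic_of_rigid:
  assumes conn: "\<And>u v. E\<^sup>*\<^sup>* u v" and fin: "\<And>v. finite {w. E v w}"
    and rigid: "\<And>n. \<exists>D. \<forall>g \<in> Aut E. \<forall>u. (E ^^ n) u (g u) \<longrightarrow>
        (\<forall>m\<le>D. \<forall>z. (E ^^ m) u z \<longrightarrow> x (g z) = x z) \<longrightarrow> g u = u"
  shows "hyperaperiodic E r (orbit_rel E r `` {x})"
proof -
  note limit = orbit_limit_Free[OF conn fin rigid]
  \<comment> \<open>As a limit of its own orbit, with \<open>h = id\<close>, the configuration is
    itself free.\<close>
  have "x \<in> Free E" by (rule limit) (auto intro!: bexI[of _ id] simp: act_id id_in_Aut)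
  moreover have "Q \<in> Free_quot E r"
    if Q: "Q \<in> config_quot_topology E r closure_of component_T E r (orbit_rel E r `` {x})" for Q
  proof -
    have Qq: "Q \<in> config_quot E r"
      using Q topspace_config_quot_topology[of E r] by (auto simp: in_closure_of)
    then obtain y where y: "Q = orbit_rel E r `` {y}" by (auto simp: config_quot_def quotient_def)
    then have yQ: "y \<in> Q" using equiv_class_self[OF equiv_orbit_rel UNIV_I] by simp
    have closure: "\<exists>Y. Y \<in> component_T E r (orbit_rel E r `` {x}) \<and> Y \<in> U"
      if "Q \<in> U" "openin (config_quot_topology E r) U" for U
      using Q that unfolding in_closure_of by (elim conjE allE[of _ U]) simp
    have "y \<in> Free E"
    proof (rule limit)
      fix F :: "'a set" assume F: "finite F"
      let ?U = "{Z \<in> config_quot E r. \<exists>z\<in>Z. \<forall>w\<in>F. z w = y w}"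
      have "Q \<in> ?U" using Qq yQ by blast
      from closure[OF this openin_quot_cylinder[OF F]]
      obtain Y where Y: "Y \<in> component_T E r (orbit_rel E r `` {x})" "Y \<in> ?U"
        by (elim exE conjE)
      from Y(2) obtain z where "z \<in> Y" "\<forall>w\<in>F. z w = y w" by blast
      with component_T_orbit[OF Y(1)] show "\<exists>h\<in>Aut E. \<forall>w\<in>F. act h x w = y w" by blast
    qed
    then show ?thesis unfolding Free_quot_def y by (rule quotientI)
  qed
  ultimately show ?thesis
    unfolding hyperaperiodic_def Free_quot_def by (auto intro: quotientI)
qed

theorem theorem3p5:
  fixes \<Delta> :: nat and E :: "'v \<Rightarrow> 'v \<Rightarrow> bool" and r :: 'v
  assumes "\<Delta> > 2" and "regular_tree \<Delta> E"
  shows "\<exists>X \<in> Free_quot E r. hyperaperiodic E r X"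
proof -
  obtain p lev where "ended_tree E p lev (\<Delta> - 1)"
    using regular_tree_imp_ended_tree[OF assms] by blast
  then interpret ended_tree E p lev "\<Delta> - 1" .
  have "finite {w. E v w}" for v using assms(2) by (simp add: regular_tree_def)
  then have "hyperaperiodic E r (orbit_rel E r `` {colour})"
    using colour_rigid conn unfolding preserved_def by (intro hyperaperiodic_of_rigid)
  then show ?thesis by (auto simp: hyperaperiodic_def)
qed

end
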